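(* Let $0<p<1$, $A\in\mathbb{R}^{m\times n}$, $\bm{b}\in\mathbb{R}^m$ and $\sigma\ge0$ be such that $\mathcal{F}:=\{\bm{x}\in\mathbb{R}^n:\|A\bm{x}-\bm{b}\|_1\le\sigma\}\ne\emptyset$ and $\|\bm{b}\|_1>\sigma$. Let $c>0$ be a constant such that $\mathrm{dist}(\bm{x},\mathcal{F})\le c\,(\|A\bm{x}-\bm{b}\|_1-\sigma)_+$ for all $\bm{x}\in\mathbb{R}^n$. Suppose that $\tilde{\bm{x}}\in\mathcal{F}$ is an arbitrary feasible point. Take any $\epsilon>0$ and consider any $\lambda\ge c\left(n^{\frac p2-1}\epsilon\right)^{-\frac1p}\|\tilde{\bm{x}}\|_p^p$. Then, for any global minimizer $\bm{x}_\lambda^*$ of $$\min_{\bm{x}\in\mathbb{R}^n}\ \|\bm{x}\|_p^p+\lambda\,(\|A\bm{x}-\bm{b}\|_1-\sigma)_+,$$ the projection $\mathcal{P}_{\mathcal{F}}(\bm{x}_\lambda^* )$ is an $\epsilon$-minimizer of the problem $$\min_{\bm{x}\in\mathbb{R}^n}\ \|\bm{x}\|_p^p\quad\text{s.t.}\quad\|A\bm{x}-\bm{b}\|_1\le\sigma .$$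
   Context: $\|\bm{x}\|_p^p:=\sum_{i=1}^n|x_i|^p$ and $(\cdot)_+:=\max\{\cdot,0\}$. $\mathrm{dist}(\bm{x},\mathcal{F})$ is the Euclidean distance from $\bm{x}$ to $\mathcal{F}$ and $\mathcal{P}_{\mathcal{F}}$ is the Euclidean projection onto the closed convex set $\mathcal{F}$. For $\epsilon>0$, a point $\bm{x}_\epsilon$ is an $\epsilon$-minimizer of the constrained problem if $\bm{x}_\epsilon\in\mathcal{F}$ and $\|\bm{x}_\epsilon\|_p^p\le\min\{\|\bm{x}\|_p^p:\bm{x}\in\mathcal{F}\}+\epsilon$. *)

theory Defs
  imports "HOL-Analysis.Analysis"
begin

definition lp_norm_pow :: "real \<Rightarrow> real ^ 'n \<Rightarrow> real"
  where "lp_norm_pow p x = (\<Sum>i\<in>UNIV. \<bar>x $ i\<bar> powr p)"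

definition l1_norm :: "real ^ 'n \<Rightarrow> real"
  where "l1_norm x = (\<Sum>i\<in>UNIV. \<bar>x $ i\<bar>)"

definition pos_part :: "real \<Rightarrow> real"
  where "pos_part t = max t 0"

definition l1_feasible_set :: "real ^ 'n ^ 'm \<Rightarrow> real ^ 'm \<Rightarrow> real \<Rightarrow> (real ^ 'n) set"
  where "l1_feasible_set A b \<sigma> = {x. l1_norm (A *v x - b) \<le> \<sigma>}"

definition penalized_objective ::
  "real \<Rightarrow> real ^ 'n ^ 'm \<Rightarrow> real ^ 'm \<Rightarrow> real \<Rightarrow> real \<Rightarrow> real ^ 'n \<Rightarrow> real"
  where "penalized_objective p A b \<sigma> lam x =
    lp_norm_pow p x + lam * pos_part (l1_norm (A *v x - b) - \<sigma>)"

(* The minimum of f over S is rendered as the value f z at a minimizer z, so the definition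
   includes the claim, implicit in writing "min" rather than "inf", that the minimum is attained. *)
definition is_eps_minimizer :: "('a \<Rightarrow> real) \<Rightarrow> 'a set \<Rightarrow> real \<Rightarrow> 'a \<Rightarrow> bool"
  where "is_eps_minimizer f S \<epsilon> x \<longleftrightarrow>
    x \<in> S \<and> (\<exists>z. is_arg_min f (\<lambda>y. y \<in> S) z \<and> f x \<le> f z + \<epsilon>)"

end

(* Since t powr p is subadditive, the objective at the projection exceeds the objective at the
   penalized minimizer by at most the value at their difference, which the power mean inequality
   bounds by the distance to the feasible set. The error bound controls that distance by the
   infeasibility, and comparing the penalized objective with the feasible point xt shows that
   lam times the infeasibility is at most the value at xt. *)
theory Submission
  imports Defs
begin

text \<open>Dividing by \<open>a + b\<close> leaves two fractions in [0, 1] that sum to 1, and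
  raising such a fraction to a power \<open>p\<close> \<le> 1 does not decrease it.\<close>

lemma powr_add_subadditive:
  fixes a b p :: real
  assumes "0 < p" "p \<le> 1" "0 \<le> a" "0 \<le> b"
  shows "(a + b) powr p \<le> a powr p + b powr p"
proof (cases "a + b = 0")
  case False
  then have s: "a + b > 0" using assms by linarith
  have "1 = a / (a + b) + b / (a + b)"
    using s by (simp add: add_divide_distrib [symmetric])
  also have "\<dots> \<le> (a / (a + b)) powr p + (b / (a + b)) powr p"
    using assms s powr_mono' [of p 1 "a / (a + b)"] powr_mono' [of p 1 "b / (a + b)"] by simp
  also have "\<dots> = (a powr p + b powr p) / (a + b) powr p"
    using assms by (simp add: powr_divide add_divide_distrib)
  finally show ?thesis
    using s by (simp add: pos_le_divide_eq)
qed (use assms in simp)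

lemma lp_norm_pow_nonneg: "0 \<le> lp_norm_pow p x"
  by (simp add: lp_norm_pow_def sum_nonneg)

lemma lp_norm_pow_pos:
  assumes "x \<noteq> 0"
  shows "0 < lp_norm_pow p x"
proof -
  obtain i where "x $ i \<noteq> 0" using assms by (auto simp: vec_eq_iff)
  then show ?thesis
    unfolding lp_norm_pow_def by (intro sum_pos2 [of _ i]) auto
qed

lemma lp_norm_pow_add_le:
  assumes "0 < p" "p \<le> 1"
  shows "lp_norm_pow p (x + y) \<le> lp_norm_pow p x + lp_norm_pow p y"
  unfolding lp_norm_pow_def sum.distrib [symmetric]
proof (rule sum_mono)
  fix i
  have "\<bar>(x + y) $ i\<bar> powr p \<le> (\<bar>x $ i\<bar> + \<bar>y $ i\<bar>) powr p"
    using assms by (intro powr_mono2) auto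
  also have "\<dots> \<le> \<bar>x $ i\<bar> powr p + \<bar>y $ i\<bar> powr p"
    using assms by (intro powr_add_subadditive) auto
  finally show "\<bar>(x + y) $ i\<bar> powr p \<le> \<bar>x $ i\<bar> powr p + \<bar>y $ i\<bar> powr p" .
qed

text \<open>The squares \<open>u i\<close> of the normalized coordinates sum to 1. Weighted AM-GM
  with weights \<open>p / 2\<close> and \<open>1 - p / 2\<close> compares each of them with the
  uniform value \<open>1 / real CARD('n)\<close>; summing over the coordinates bounds the normalized
  left-hand side by 1.\<close>

lemma lp_norm_pow_le_norm_powr:
  fixes x :: "real ^ 'n"
  assumes "0 < p" "p < 2"
  shows "real CARD('n) powr (p / 2 - 1) * lp_norm_pow p x \<le> norm x powr p"
proof (cases "x = 0")
  case False
  then have r: "norm x > 0" by simp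
  define u where "u i = (x $ i)\<^sup>2 / (norm x)\<^sup>2" for i
  have sum_u: "(\<Sum>i\<in>UNIV. u i) = 1"
    using r by (simp add: u_def norm_vec_def L2_set_def sum_nonneg flip: sum_divide_distrib)
  have u_powr: "u i powr (p / 2) = \<bar>x $ i\<bar> powr p / norm x powr p" for i
  proof -
    have "u i = (\<bar>x $ i\<bar> / norm x) powr 2"
      using r by (simp add: u_def power_divide)
    then show ?thesis
      by (simp add: powr_powr powr_divide del: powr_numeral)
  qed
  have le: "u i powr (p / 2) * real CARD('n) powr (p / 2 - 1)
      \<le> p / 2 * u i + (1 - p / 2) * (1 / real CARD('n))" for i
  \<comment> \<open>Young's inequality is applied to positive numbers only; for a zero coordinate
    the left-hand side vanishes because \<open>0 powr (p / 2) = 0\<close>.\<close>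
  proof (cases "x $ i = 0")
    case True
    then show ?thesis using assms by (simp add: u_def)
  next
    case False
    have "(1 / real CARD('n)) powr (1 - p / 2) = real CARD('n) powr (p / 2 - 1)"
      by (simp add: powr_divide flip: powr_minus_divide)
    then show ?thesis
      using Youngs_inequality_0 [of "p / 2" "1 - p / 2" "u i" "1 / real CARD('n)"] assms r False
      by (simp add: u_def)
  qed
  have "(\<Sum>i\<in>UNIV. u i powr (p / 2) * real CARD('n) powr (p / 2 - 1))
      \<le> (\<Sum>i::'n\<in>UNIV. p / 2 * u i + (1 - p / 2) * (1 / real CARD('n)))"
    by (rule sum_mono) (rule le)
  also have "\<dots> = p / 2 * (\<Sum>i\<in>UNIV. u i) + (1 - p / 2)"
    by (simp add: sum.distrib sum_distrib_left)
  also have "\<dots> = 1" by (simp add: sum_u)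
  finally have "lp_norm_pow p x / norm x powr p * real CARD('n) powr (p / 2 - 1) \<le> 1"
    by (simp add: u_powr lp_norm_pow_def sum_divide_distrib sum_distrib_right)
  then show ?thesis
    using r by (simp add: field_simps)
qed (use assms in \<open>simp add: lp_norm_pow_def\<close>)

lemma continuous_on_lp_norm_pow:
  assumes "0 < p"
  shows "continuous_on S (lp_norm_pow p)"
  unfolding lp_norm_pow_def using assms
  by (intro continuous_intros continuous_on_powr') auto

lemma bounded_lp_norm_pow_sublevel:
  fixes M :: real
  assumes "0 < p"
  shows "bounded {x :: real ^ 'n. lp_norm_pow p x \<le> M}"
proof (rule boundedI)
  fix x :: "real ^ 'n"
  assume "x \<in> {x. lp_norm_pow p x \<le> M}"
  then have M: "lp_norm_pow p x \<le> M" by simp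
  have "\<bar>x $ i\<bar> \<le> M powr (1 / p)" for i
  proof -
    have "\<bar>x $ i\<bar> powr p \<le> lp_norm_pow p x"
      unfolding lp_norm_pow_def by (rule member_le_sum) auto
    then have "(\<bar>x $ i\<bar> powr p) powr (1 / p) \<le> M powr (1 / p)"
      using assms M by (intro powr_mono2) auto
    then show ?thesis using assms by (simp add: powr_powr)
  qed
  then have "(\<Sum>i\<in>UNIV. \<bar>x $ i\<bar>) \<le> (\<Sum>i::'n\<in>UNIV. M powr (1 / p))"
    by (intro sum_mono)
  then show "norm x \<le> real CARD('n) * M powr (1 / p)"
    using norm_le_l1_cart [of x] by simp
qed

text \<open>\<open>S\<close> may be unbounded, but its intersection with a sublevel set is compact.
  This supplies the attained minimum that \<open>is_eps_minimizer\<close> asks for.\<close>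

lemma lp_norm_pow_attains_min:
  fixes S :: "(real ^ 'n) set"
  assumes "0 < p" "closed S" "S \<noteq> {}"
  shows "\<exists>z. is_arg_min (lp_norm_pow p) (\<lambda>y. y \<in> S) z"
proof -
  obtain x0 where x0: "x0 \<in> S" using assms by auto
  define L where "L = {x :: real ^ 'n. lp_norm_pow p x \<le> lp_norm_pow p x0}"
  have "closed L"
    unfolding L_def using assms by (intro closed_Collect_le continuous_on_lp_norm_pow) auto
  then have "compact (S \<inter> L)"
    using assms bounded_lp_norm_pow_sublevel [of p "lp_norm_pow p x0"]
    by (auto simp: compact_eq_bounded_closed L_def bounded_Int)
  moreover have "x0 \<in> S \<inter> L" using x0 by (simp add: L_def)
  ultimately obtain z where z: "z \<in> S \<inter> L" "\<And>y. y \<in> S \<inter> L \<Longrightarrow> lp_norm_pow p z \<le> lp_norm_pow p y"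
    using continuous_attains_inf [of "S \<inter> L" "lp_norm_pow p"] continuous_on_lp_norm_pow assms(1)
    by blast
  \<comment> \<open>Outside \<open>L\<close> the value exceeds the one at \<open>x0\<close>, hence
    also the one at \<open>z\<close>.\<close>
  have "lp_norm_pow p z \<le> lp_norm_pow p y" if "y \<in> S" for y
  proof (cases "y \<in> L")
    case False
    then show ?thesis using z(1) by (simp add: L_def)
  qed (use z that in auto)
  then show ?thesis using z(1) by (auto simp: is_arg_min_linorder)
qed

lemma closed_l1_feasible_set: "closed (l1_feasible_set A b \<sigma>)"
  unfolding l1_feasible_set_def l1_norm_def
  by (intro closed_Collect_le continuous_intros)

theorem theoremC3:
  fixes p \<sigma> c \<epsilon> lam :: real
    and A :: "real ^ 'n ^ 'm"
    and b :: "real ^ 'm"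
    and xt xs :: "real ^ 'n"
  assumes "0 < p" and "p < 1"
    and "\<sigma> \<ge> 0"
    and "l1_feasible_set A b \<sigma> \<noteq> {}"
    and "l1_norm b > \<sigma>"
    and "c > 0"
    and "\<And>x. infdist x (l1_feasible_set A b \<sigma>) \<le> c * pos_part (l1_norm (A *v x - b) - \<sigma>)"
    and "xt \<in> l1_feasible_set A b \<sigma>"
    and "\<epsilon> > 0"
    and "lam \<ge> c * (real CARD('n) powr (p / 2 - 1) * \<epsilon>) powr (- (1 / p)) * lp_norm_pow p xt"
    and "is_arg_min (penalized_objective p A b \<sigma> lam) (\<lambda>x. True) xs"
  shows "is_eps_minimizer (lp_norm_pow p) (l1_feasible_set A b \<sigma>) \<epsilon>
    (closest_point (l1_feasible_set A b \<sigma>) xs)"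
proof -
  define F where "F = l1_feasible_set A b \<sigma>"
  define y where "y = closest_point F xs"
  define k where "k = real CARD('n) powr (p / 2 - 1)"
  define h where "h = pos_part (l1_norm (A *v xs - b) - \<sigma>)"
  have F: "closed F" "F \<noteq> {}"
    using assms(4) closed_l1_feasible_set by (auto simp: F_def)
  have yF: "y \<in> F"
    unfolding y_def using F by (rule closest_point_in_set)
  have k: "k > 0" by (simp add: k_def)
  have h: "h \<ge> 0" by (simp add: h_def pos_part_def)
  \<comment> \<open>The penalty vanishes on \<open>F\<close>. This bound is used twice: at
    \<open>xt\<close> to control the infeasibility \<open>h\<close>, and at a constrained minimizer
    to compare objectives.\<close>
  have feasible: "lp_norm_pow p xs + lam * h \<le> lp_norm_pow p z" if "z \<in> F" for z
  proof -
    have "penalized_objective p A b \<sigma> lam xs \<le> penalized_objective p A b \<sigma> lam z"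
      using assms(11) by (simp add: is_arg_min_linorder)
    then show ?thesis
      using that by (simp add: penalized_objective_def h_def F_def l1_feasible_set_def pos_part_def)
  qed
  \<comment> \<open>The origin is infeasible, its residual being \<open>- b\<close> with
    \<open>l1_norm b > \<sigma>\<close>. Hence \<open>lam\<close> is positive and can be cancelled
    below.\<close>
  have "xt \<noteq> 0"
    using assms(5,8) by (auto simp: l1_feasible_set_def l1_norm_def)
  then have fxt: "lp_norm_pow p xt > 0" by (rule lp_norm_pow_pos)
  \<comment> \<open>\<open>q\<close> is the admissible distance from \<open>xs\<close> to
    \<open>F\<close>: by the power mean bound, a displacement of norm at most \<open>q\<close> has
    \<open>lp_norm_pow\<close> at most \<epsilon>. The threshold for \<open>lam\<close> is
    \<open>c * lp_norm_pow p xt / q\<close>.\<close>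
  define q where "q = (k * \<epsilon>) powr (1 / p)"
  have q: "q > 0" using k assms(9) by (simp add: q_def)
  have lam: "lam \<ge> c * lp_norm_pow p xt / q"
    using assms(10) by (simp add: k_def q_def powr_minus field_simps)
  then have lam_pos: "lam > 0"
    using assms(6) fxt q by (smt (verit) divide_pos_pos mult_pos_pos)

  have "lam * h \<le> lp_norm_pow p xt"
    using feasible [of xt] assms(8) lp_norm_pow_nonneg [of p xs] by (simp add: F_def)
  then have "lam * (c * h) \<le> c * lp_norm_pow p xt"
    using assms(6) by simp
  also have "\<dots> \<le> lam * q"
    using lam q by (simp add: pos_divide_le_eq)
  finally have "c * h \<le> q" using lam_pos by simp
  moreover have "norm (y - xs) \<le> c * h"
  proof -
    have "norm (y - xs) = infdist xs F"
      using F setdist_closest_point [of F xs]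
      by (simp add: y_def infdist_eq_setdist dist_norm norm_minus_commute)
    then show ?thesis using assms(7) by (simp add: F_def h_def)
  qed
  ultimately have "norm (y - xs) powr p \<le> q powr p"
    using assms(1) by (intro powr_mono2) auto
  also have "\<dots> = k * \<epsilon>"
    using assms(1,9) k by (simp add: q_def powr_powr)
  finally have "k * lp_norm_pow p (y - xs) \<le> k * \<epsilon>"
    using lp_norm_pow_le_norm_powr [of p "y - xs"] assms(1,2)
    unfolding k_def by linarith
  then have diff: "lp_norm_pow p (y - xs) \<le> \<epsilon>" using k by simp

  obtain z where z: "is_arg_min (lp_norm_pow p) (\<lambda>y. y \<in> F) z"
    using lp_norm_pow_attains_min assms(1) F by blast
  have "lp_norm_pow p y \<le> lp_norm_pow p xs + lp_norm_pow p (y - xs)"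
    using lp_norm_pow_add_le [of p xs "y - xs"] assms(1,2) by simp
  \<comment> \<open>The nonnegative penalty \<open>lam * h\<close> is dropped, so the value at
    \<open>xs\<close> is at most the constrained minimum.\<close>
  also have "\<dots> \<le> lp_norm_pow p z + \<epsilon>"
  proof -
    have "z \<in> F" using z by (simp add: is_arg_min_def)
    moreover have "0 \<le> lam * h" using lam_pos h by simp
    ultimately show ?thesis using feasible [of z] diff by linarith
  qed
  finally show ?thesis
    using z yF unfolding is_eps_minimizer_def y_def F_def by blast
qed

end
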